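(* Let $\Delta$ be any countable compact subset of $\mathbb{R}$ such that $\partial^{(\infty)}\Delta\ne\emptyset$. Then there exists a well-ordered decreasing chain of order type $\mathfrak{c}$ of prime $z$-filters on $\mathbb{R}$ such that each prime $z$-filter in the chain contains $\Delta$ (as an element).
   Context: $\mathfrak{c}=2^{\aleph_0}$, identified with the smallest ordinal of that cardinality. A well-ordered decreasing chain of order type $\kappa$ is a family $(\mathcal{Q}_\alpha:\alpha\in\kappa)$ with $\mathcal{Q}_\beta\subsetneq\mathcal{Q}_\alpha$ whenever $\alpha<\beta$ in $\kappa$. For a compact space $K$, $\partial^{(1)}K=\partial K$ is the set of all limit points of $K$, $\partial^{(n+1)}K=\partial(\partial^{(n)}K)$ for $n\ge1$, and $\partial^{(\infty)}K=\bigcap_{n\ge1}\partial^{(n)}K$ (here $\Delta$ is viewed as a compact space in its own right). $\mathbf{Z}(f)=f^{-1}(0)$ and $\mathbf{Z}[\mathbb{R}]=\{\mathbf{Z}(f):f\in C(\mathbb{R})\}$, where $C(\mathbb{R})$ is the algebra of continuous functions on $\mathbb{R}$. A $z$-filter on $\mathbb{R}$ is a non-empty proper subset of $\mathbf{Z}[\mathbb{R}]$ closed under finite intersections and under supersets belonging to $\mathbf{Z}[\mathbb{R}]$. A $z$-filter $\mathcal{P}$ is prime if $Z_1\cup Z_2\notin\mathcal{P}$ whenever $Z_1,Z_2\in\mathbf{Z}[\mathbb{R}]\setminus\mathcal{P}$. *)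

theory Defs
  imports "HOL-Analysis.Analysis"
begin

text \<open>
  The set \<open>K\<close> carries its subspace topology, so that \<open>derived_set K\<close> is the set of limit points
  of the space \<open>K\<close>; in particular it is a subset of \<open>K\<close>, also when \<open>K\<close> is not closed.
\<close>

definition derived_set :: "real set \<Rightarrow> real set" where
  "derived_set K = (top_of_set K) derived_set_of K"

definition derived_iter :: "nat \<Rightarrow> real set \<Rightarrow> real set" where
  "derived_iter n K = (derived_set ^^ n) K"

definition derived_infinity :: "real set \<Rightarrow> real set" where
  "derived_infinity K = (\<Inter>n\<in>{1..}. derived_iter n K)"

definition zero_set :: "(real \<Rightarrow> real) \<Rightarrow> real set" where
  "zero_set f = f -` {0}"

definition zero_sets :: "real set set" where
  "zero_sets = {zero_set f |f. continuous_on UNIV f}"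

definition z_filter :: "real set set \<Rightarrow> bool" where
  "z_filter P \<longleftrightarrow> P \<noteq> {} \<and> P \<subset> zero_sets \<and>
     (\<forall>A\<in>P. \<forall>B\<in>P. A \<inter> B \<in> P) \<and>
     (\<forall>A\<in>P. \<forall>B\<in>zero_sets. A \<subseteq> B \<longrightarrow> B \<in> P)"

definition prime_z_filter :: "real set set \<Rightarrow> bool" where
  "prime_z_filter P \<longleftrightarrow> z_filter P \<and>
     (\<forall>A\<in>zero_sets - P. \<forall>B\<in>zero_sets - P. A \<union> B \<notin> P)"

text \<open>
  The cardinal \<open>2\<close> to the power \<open>\<aleph>\<^sub>0\<close>. As always in the cardinal library, a cardinal is represented
  by a (reflexive) well-order that is minimal among the well-orders of its field, that is, by an
  initial ordinal; the elements of its field, here all of \<open>nat \<Rightarrow> bool\<close>, play the role of the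
  ordinals below it.
\<close>

definition continuum :: "(nat \<Rightarrow> bool) rel" where
  "continuum = BNF_Cardinal_Arithmetic.cexp BNF_Cardinal_Arithmetic.ctwo natLeq"

text \<open>A family indexed by the well-order \<open>r\<close>; only its values on \<open>Field r\<close> matter.\<close>

definition decreasing_chain :: "'i rel \<Rightarrow> ('i \<Rightarrow> 'a set) \<Rightarrow> bool" where
  "decreasing_chain r Q \<longleftrightarrow> Well_order r \<and>
     (\<forall>\<alpha> \<beta>. (\<alpha>, \<beta>) \<in> r \<and> \<alpha> \<noteq> \<beta> \<longrightarrow> Q \<beta> \<subset> Q \<alpha>)"

end

theory Submission
  imports Defs
begin

text \<open>
  A point \<open>x\<close> of Cantor--Bendixson rank exactly \<open>n\<close> carries a strictly decreasing tower of \<open>n + 1\<close>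
  prime \<open>z\<close>-filters: the largest consists of the closed sets containing \<open>x\<close>, and the others are
  ultrafilter limits of the towers at points of rank \<open>n - 1\<close> converging to \<open>x\<close>. The iterated
  derived sets of \<open>\<Delta>\<close> tell the members of a tower apart. As \<open>\<Delta>\<close> is countable, Baire's theorem
  produces points of every finite rank, so there are towers of unbounded finite height at points with
  pairwise disjoint neighbourhoods. An ultrafilter limit along these points turns a function that
  selects a level of each tower into a prime \<open>z\<close>-filter. As in the independent families of Engelking
  and Karlowicz, there are level functions indexed by \<open>nat \<Rightarrow> bool\<close> that, modulo a suitable
  ultrafilter, increase strictly along any given linear order of their index set; they yield the chain.
\<close>

section \<open>Ultrafilters\<close>

definition ultrafilter :: "'a filter \<Rightarrow> bool" where
  "ultrafilter U \<longleftrightarrow> U \<noteq> bot \<and> (\<forall>P. eventually P U \<or> eventually (\<lambda>x. \<not> P x) U)"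

text \<open>Zorn's lemma for the reversed order gives a filter minimal among the proper filters
  below \<open>F\<close>, and minimality forces it to decide every predicate.\<close>

lemma ultrafilter_exists:
  assumes "F \<noteq> bot"
  obtains U where "U \<le> F" "ultrafilter U"
proof -
  let ?A = "{G. G \<le> F \<and> G \<noteq> bot}"
  have "\<exists>M\<in>?A. \<forall>G\<in>?A. M \<ge> G \<longrightarrow> G = M"
  proof (rule predicate_Zorn)
    show "partial_order_on ?A (relation_of (\<ge>) ?A)"
      by (rule partial_order_on_relation_ofI) auto
    fix C assume C: "C \<in> Chains (relation_of (\<ge>) ?A)"
    then have sub: "C \<subseteq> ?A" and total: "\<forall>G\<in>C. \<forall>H\<in>C. G \<le> H \<or> H \<le> G"
      unfolding Chains_def relation_of_def by auto
    show "\<exists>M\<in>?A. \<forall>G\<in>C. G \<ge> M"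
    proof (cases "C = {}")
      case True
      then show ?thesis using assms by auto
    next
      case False
      \<comment> \<open>In a chain, what holds eventually for the infimum already holds eventually
        for a member, so the infimum stays proper.\<close>
      then have "eventually P (Inf C) \<longleftrightarrow> (\<exists>G\<in>C. eventually P G)" for P
        using total by (intro eventually_Inf_base) (simp, metis inf.order_iff inf_commute)
      then have "Inf C \<noteq> bot"
        using sub by (auto simp: trivial_limit_def)
      moreover have "Inf C \<le> F"
        using False sub by (metis (mono_tags, lifting) Inf_lower2 ex_in_conv mem_Collect_eq subsetD)
      ultimately show ?thesis
        by (intro bexI[of _ "Inf C"]) (auto simp: Inf_lower)
    qed
  qed
  then obtain U where U: "U \<le> F" "U \<noteq> bot"
    and min: "\<And>G. G \<le> U \<Longrightarrow> G \<noteq> bot \<Longrightarrow> G = U"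
    by (smt (verit) mem_Collect_eq order_trans)
  have "eventually P U" if "\<not> eventually (\<lambda>x. \<not> P x) U" for P
  proof -
    have "inf U (principal {x. P x}) = U"
      using that by (intro min) (auto simp: trivial_limit_def eventually_inf_principal)
    moreover have "eventually P (inf U (principal {x. P x}))"
      by (simp add: eventually_inf_principal)
    ultimately show ?thesis by simp
  qed
  then show thesis
    using U that unfolding ultrafilter_def by blast
qed

lemma ultrafilter_eventually_not:
  "ultrafilter U \<Longrightarrow> eventually (\<lambda>x. \<not> P x) U \<longleftrightarrow> \<not> eventually P U"
  unfolding ultrafilter_def using eventually_conj[of P U "\<lambda>x. \<not> P x"] by auto

section \<open>Limits of prime z-filters\<close>

lemma zero_sets_eq_closed: "zero_sets = {Z. closed Z}"
proof (intro equalityI subsetI)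
  fix Z assume "Z \<in> zero_sets"
  then obtain f :: "real \<Rightarrow> real" where "Z = f -` {0}" "continuous_on UNIV f"
    unfolding zero_sets_def zero_set_def by blast
  then show "Z \<in> {Z. closed Z}"
    by (simp add: closed_vimage)
next
  fix Z :: "real set" assume "Z \<in> {Z. closed Z}"
  then have Z: "closed Z" by simp
  have zero_setI: "zero_set f \<in> zero_sets" if "continuous_on UNIV f" for f
    unfolding zero_sets_def mem_Collect_eq by (rule exI[of _ f]) (simp add: that)
  show "Z \<in> zero_sets"
  \<comment> \<open>\<open>infdist x {}\<close> is 0 by convention, so the empty set needs a
    function of its own.\<close>
  proof (cases "Z = {}")
    case True
    then show ?thesis
      using zero_setI[of "\<lambda>_. 1"] by (simp add: zero_set_def)
  next
    case False
    then have "zero_set (\<lambda>x. infdist x Z) = Z"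
      using in_closed_iff_infdist_zero[OF Z] by (auto simp: zero_set_def)
    moreover have "continuous_on UNIV (\<lambda>x. infdist x Z)"
      by (intro continuous_intros)
    ultimately show ?thesis
      using zero_setI[of "\<lambda>x. infdist x Z"] by simp
  qed
qed

text \<open>Upward closure lets non-emptiness and properness be tested on the single sets
  \<open>UNIV\<close> and \<open>{}\<close>.\<close>

lemma prime_z_filter_iff:
  "prime_z_filter P \<longleftrightarrow> P \<subseteq> {Z. closed Z} \<and> UNIV \<in> P \<and> {} \<notin> P \<and>
     (\<forall>A\<in>P. \<forall>B\<in>P. A \<inter> B \<in> P) \<and>
     (\<forall>A\<in>P. \<forall>B. closed B \<and> A \<subseteq> B \<longrightarrow> B \<in> P) \<and>
     (\<forall>A B. closed A \<and> closed B \<and> A \<union> B \<in> P \<longrightarrow> A \<in> P \<or> B \<in> P)"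
  (is "_ \<longleftrightarrow> ?R")
proof
  assume "prime_z_filter P"
  note P = this[unfolded prime_z_filter_def z_filter_def zero_sets_eq_closed]
  then have ne: "P \<noteq> {}" and sub: "P \<subset> {Z. closed Z}"
    and up: "\<And>A B. A \<in> P \<Longrightarrow> closed B \<Longrightarrow> A \<subseteq> B \<Longrightarrow> B \<in> P"
    by simp_all
  have "UNIV \<in> P" using ne up by (metis closed_UNIV equals0I subset_UNIV)
  moreover have "{} \<notin> P"
  proof
    assume "{} \<in> P"
    then have "{Z. closed Z} \<subseteq> P" using up by auto
    then show False using sub by (simp add: less_le_not_le)
  qed
  moreover have "A \<in> P \<or> B \<in> P" if "closed A \<and> closed B \<and> A \<union> B \<in> P" for A B
  proof (rule ccontr)
    assume "\<not> ?thesis"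
    then have "A \<in> {Z. closed Z} - P" "B \<in> {Z. closed Z} - P" using that by auto
    then show False using conjunct2[OF P] that by blast
  qed
  ultimately show ?R
    using P psubset_imp_subset[OF sub] by (intro conjI allI impI) simp_all
next
  assume R: ?R
  then have "P \<noteq> {}" "P \<subset> {Z. closed Z}" by auto
  moreover have "A \<union> B \<notin> P" if "A \<in> {Z. closed Z} - P" "B \<in> {Z. closed Z} - P" for A B
    using that R by (metis DiffD1 DiffD2 mem_Collect_eq)
  ultimately show "prime_z_filter P"
    unfolding prime_z_filter_def z_filter_def zero_sets_eq_closed
    using R by (intro conjI ballI) simp_all
qed

lemma prime_z_filter_point: "prime_z_filter {Z. closed Z \<and> x \<in> Z}"
  unfolding prime_z_filter_iff by auto

lemma prime_z_filter_Un_iff: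
  assumes "prime_z_filter P" "closed A" "closed B"
  shows "A \<union> B \<in> P \<longleftrightarrow> A \<in> P \<or> B \<in> P"
  using assms unfolding prime_z_filter_iff by (meson Un_upper1 Un_upper2 closed_Un)

lemma prime_z_filter_Int_iff:
  assumes "prime_z_filter P" "closed A" "closed B"
  shows "A \<inter> B \<in> P \<longleftrightarrow> A \<in> P \<and> B \<in> P"
  using assms unfolding prime_z_filter_iff by (meson Int_lower1 Int_lower2)

lemma prime_z_filter_mono:
  assumes "prime_z_filter P" "A \<in> P" "A \<subseteq> B" "closed B"
  shows "B \<in> P"
  using assms unfolding prime_z_filter_iff by blast

text \<open>For an ultrafilter \<open>U\<close> this is the pointwise limit, with families of closed
  sets viewed as points of a power of the two-point space.\<close>

definition z_limit :: "('i \<Rightarrow> real set set) \<Rightarrow> 'i filter \<Rightarrow> real set set" where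
  "z_limit F U = {Z. closed Z \<and> eventually (\<lambda>i. Z \<in> F i) U}"

text \<open>Each clause concerns finitely many closed sets at each index and so passes to the limit;
  for \<open>{}\<close> and for unions, the ultrafilter turns "not eventually" into "eventually
  not".\<close>

lemma prime_z_filter_limit:
  assumes U: "ultrafilter U" and F: "eventually (\<lambda>i. prime_z_filter (F i)) U"
  shows "prime_z_filter (z_limit F U)"
  unfolding prime_z_filter_iff
proof (intro conjI ballI allI impI; (elim conjE)?)
  show "z_limit F U \<subseteq> {Z. closed Z}"
    by (auto simp: z_limit_def)
  show "UNIV \<in> z_limit F U"
    using F by (auto simp: z_limit_def prime_z_filter_iff elim: eventually_mono)
  have "eventually (\<lambda>i. {} \<notin> F i) U"
    using F by (auto simp: prime_z_filter_iff elim: eventually_mono)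
  then show "{} \<notin> z_limit F U"
    using U by (simp add: z_limit_def ultrafilter_eventually_not)
next
  fix A B assume AB: "A \<in> z_limit F U" "B \<in> z_limit F U"
  then have "eventually (\<lambda>i. A \<in> F i) U" "eventually (\<lambda>i. B \<in> F i) U"
    by (auto simp: z_limit_def)
  with F have "eventually (\<lambda>i. A \<inter> B \<in> F i) U"
    by eventually_elim (auto simp: prime_z_filter_iff)
  then show "A \<inter> B \<in> z_limit F U"
    using AB by (auto simp: z_limit_def)
next
  fix A B assume AB: "A \<in> z_limit F U" "closed B" "A \<subseteq> B"
  then have "eventually (\<lambda>i. A \<in> F i) U"
    by (auto simp: z_limit_def)
  with F have "eventually (\<lambda>i. B \<in> F i) U"
    by eventually_elim (use AB prime_z_filter_mono in blast)
  then show "B \<in> z_limit F U"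
    using AB by (auto simp: z_limit_def)
next
  fix A B assume AB: "closed A" "closed B" "A \<union> B \<in> z_limit F U"
  show "A \<in> z_limit F U \<or> B \<in> z_limit F U"
  proof (rule ccontr)
    assume "\<not> ?thesis"
    then have "eventually (\<lambda>i. A \<notin> F i) U" "eventually (\<lambda>i. B \<notin> F i) U"
      using AB U by (auto simp: z_limit_def ultrafilter_eventually_not)
    with F have "eventually (\<lambda>i. A \<union> B \<notin> F i) U"
      by eventually_elim (use AB prime_z_filter_Un_iff in blast)
    then show False
      using AB U by (simp add: z_limit_def ultrafilter_eventually_not)
  qed
qed

section \<open>Iterated derived sets\<close>

lemma derived_set_eq: "derived_set K = {x \<in> K. x islimpt K}"
  unfolding derived_set_def derived_set_of_def islimpt_def
  by (auto simp: openin_open; blast)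

lemma derived_iter_0 [simp]: "derived_iter 0 K = K"
  and derived_iter_Suc: "derived_iter (Suc n) K = derived_set (derived_iter n K)"
  by (simp_all add: derived_iter_def)

lemma closed_derived_iter:
  assumes "closed K"
  shows "closed (derived_iter n K)"
proof (induction n)
  case (Suc n)
  have "derived_set (derived_iter n K) = {x. x islimpt derived_iter n K}"
    using Suc by (auto simp: derived_set_eq closed_limpt)
  then show ?case
    by (simp add: derived_iter_Suc closed_limpts)
qed (use assms in simp)

lemma derived_iter_antimono:
  assumes "m \<le> n"
  shows "derived_iter n K \<subseteq> derived_iter m K"
  using assms by (rule lift_Suc_antimono_le[rotated]) (auto simp: derived_iter_Suc derived_set_eq)

definition exact_rank :: "real set \<Rightarrow> nat \<Rightarrow> real set" where
  "exact_rank K n = derived_iter n K - derived_iter (Suc n) K"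

lemma exact_rank_mem_iff:
  assumes "x \<in> exact_rank K n"
  shows "x \<in> derived_iter m K \<longleftrightarrow> m \<le> n"
proof (cases "m \<le> n")
  case True
  then show ?thesis
    using assms derived_iter_antimono[of m n K] by (auto simp: exact_rank_def)
next
  case False
  then show ?thesis
    using assms derived_iter_antimono[of "Suc n" m K] by (auto simp: exact_rank_def)
qed

text \<open>\<open>x\<close> is a limit point of the n-th derived set but not of the next one, so
  the points lost between the two accumulate at \<open>x\<close>.\<close>

lemma islimpt_exact_rank:
  assumes x: "x \<in> exact_rank K (Suc n)"
  shows "x islimpt exact_rank K n"
proof -
  from x have 1: "x islimpt derived_iter n K" and 2: "\<not> x islimpt derived_iter (Suc n) K"
    by (auto simp: exact_rank_def derived_iter_Suc derived_set_eq)
  have "derived_iter n K \<subseteq> exact_rank K n \<union> derived_iter (Suc n) K"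
    by (auto simp: exact_rank_def)
  with 1 have "x islimpt exact_rank K n \<union> derived_iter (Suc n) K"
    by (rule islimpt_subset)
  with 2 show ?thesis
    by (simp add: islimpt_Un)
qed

text \<open>Were \<open>K\<close> perfect, each \<open>K - {a}\<close> would be open and dense in
  \<open>K\<close>; these countably many sets have empty intersection, against Baire's
  theorem.\<close>

lemma countable_closed_has_isolated_point:
  fixes K :: "real set"
  assumes "closed K" "countable K" "K \<noteq> {}"
  shows "derived_set K \<noteq> K"
proof
  assume perfect: "derived_set K = K"
  have "K \<subseteq> closure (\<Inter>((\<lambda>a. K - {a}) ` K))"
  proof (rule Baire)
    fix T assume "T \<in> (\<lambda>a. K - {a}) ` K"
    then obtain a where a: "a \<in> K" "T = K - {a}" by blast
    have "x islimpt K - {a}" if "x \<in> K" for x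
      using perfect that islimpt_insert[of x a "K - {a}"] a(1)
      by (auto simp: derived_set_eq insert_absorb)
    then show "openin (top_of_set K) T \<and> K \<subseteq> closure T"
      by (auto simp: a closure_def intro!: openin_diff)
  qed (use assms in auto)
  moreover have "\<Inter>((\<lambda>a. K - {a}) ` K) = {}"
    using assms(3) by auto
  ultimately show False
    using assms(3) by simp
qed

text \<open>The n-th derived set is closed, countable and non-empty, hence has an isolated point,
  which the next derivation removes.\<close>

lemma exact_rank_nonempty:
  assumes "closed K" "countable K" "derived_infinity K \<noteq> {}"
  shows "exact_rank K n \<noteq> {}"
proof -
  have "derived_infinity K \<subseteq> derived_iter (Suc n) K"
    by (auto simp: derived_infinity_def)
  then have "derived_iter (Suc n) K \<noteq> {}"
    using assms(3) by blast
  moreover have sub: "derived_iter m K \<subseteq> K" for m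
    using derived_iter_antimono[of 0 m K] by simp
  moreover have "derived_iter (Suc n) K \<subseteq> derived_iter n K"
    by (rule derived_iter_antimono) simp
  ultimately have "derived_iter n K \<noteq> {}" "derived_iter (Suc n) K \<subseteq> derived_iter n K"
    by auto
  moreover from this have "derived_iter (Suc n) K \<noteq> derived_iter n K"
    unfolding derived_iter_Suc
    using closed_derived_iter[OF assms(1)] countable_subset[OF sub assms(2)]
    by (intro countable_closed_has_isolated_point)
  ultimately show ?thesis
    by (auto simp: exact_rank_def)
qed

section \<open>Towers of prime z-filters\<close>

text \<open>The clause on \<open>derived_iter\<close> says that climbing \<open>i\<close> levels
  lowers the visible rank from \<open>n\<close> to \<open>n - i\<close>, which tells the levels
  apart; the last clause makes every level local at \<open>x\<close>.\<close>

definition tower :: "real set \<Rightarrow> nat \<Rightarrow> real \<Rightarrow> (nat \<Rightarrow> real set set) \<Rightarrow> bool" where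
  "tower K n x F \<longleftrightarrow> F 0 = {Z. closed Z \<and> x \<in> Z} \<and>
     (\<forall>i\<le>n. prime_z_filter (F i)) \<and> (\<forall>i<n. F (Suc i) \<subseteq> F i) \<and>
     (\<forall>i\<le>n. \<forall>m. derived_iter m K \<in> F i \<longleftrightarrow> m + i \<le> n) \<and>
     (\<forall>i\<le>n. \<forall>S. closed S \<and> x \<in> interior S \<longrightarrow> S \<in> F i)"

lemma tower_exists:
  assumes K: "closed K"
  shows "x \<in> exact_rank K n \<Longrightarrow> \<exists>F. tower K n x F"
proof (induction n arbitrary: x)
  case (0 x)
  then have "tower K 0 x (\<lambda>_. {Z. closed Z \<and> x \<in> Z})"
    using closed_derived_iter[OF K] interior_subset exact_rank_mem_iff[OF 0]
    by (auto simp: tower_def prime_z_filter_point)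
  then show ?case by blast
next
  case (Suc n x)
  obtain G where G: "\<And>y. y \<in> exact_rank K n \<Longrightarrow> tower K n y (G y)"
    using Suc.IH by metis
  have "at x within exact_rank K n \<noteq> bot"
    using islimpt_exact_rank[OF Suc.prems] by (simp add: trivial_limit_within)
  then obtain V where V: "V \<le> at x within exact_rank K n" "ultrafilter V"
    by (rule ultrafilter_exists)
  have ev: "eventually (\<lambda>y. y \<in> exact_rank K n) V"
    using V(1) by (auto intro: filter_leD simp: eventually_at_filter)
  have ev_open: "eventually (\<lambda>y. y \<in> T) V" if "open T" "x \<in> T" for T
    by (rule filter_leD[OF V(1)]) (use that in \<open>auto simp: eventually_at_topological\<close>)
  have ev_const: "eventually (\<lambda>y. P) V \<longleftrightarrow> P" for P
    using V(2) by (auto simp: ultrafilter_def)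
  \<comment> \<open>The levels of the towers at nearby \<open>y\<close> move up by one index, making
    room for the point filter of \<open>x\<close> at index 0.\<close>
  define F where "F i = (case i of 0 \<Rightarrow> {Z. closed Z \<and> x \<in> Z} | Suc j \<Rightarrow> z_limit (\<lambda>y. G y j) V)" for i
  have F0: "F 0 = {Z. closed Z \<and> x \<in> Z}" and FS: "F (Suc j) = z_limit (\<lambda>y. G y j) V" for j
    by (simp_all add: F_def)
  have "tower K (Suc n) x F"
    unfolding tower_def
  proof (intro conjI allI impI)
    show "F 0 = {Z. closed Z \<and> x \<in> Z}" by (rule F0)
  next
    fix i assume i: "i \<le> Suc n"
    show "prime_z_filter (F i)"
    proof (cases i)
      case (Suc j)
      have "eventually (\<lambda>y. prime_z_filter (G y j)) V"
        using ev by eventually_elim (use G i Suc in \<open>auto simp: tower_def\<close>)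
      then show ?thesis
        by (simp add: Suc FS prime_z_filter_limit V(2))
    qed (simp add: F0 prime_z_filter_point)
  next
    fix i assume i: "i < Suc n"
    show "F (Suc i) \<subseteq> F i"
    proof (cases i)
      case 0
      show ?thesis
      proof
        fix Z assume "Z \<in> F (Suc i)"
        then have Z: "closed Z" "eventually (\<lambda>y. Z \<in> G y 0) V"
          by (auto simp: 0 FS z_limit_def)
        \<comment> \<open>Index 0 at \<open>y\<close> is the point filter, so \<open>V\<close>-most
          \<open>y\<close> lie in \<open>Z\<close>; as \<open>V\<close> converges to
          \<open>x\<close> and \<open>Z\<close> is closed, so does \<open>x\<close>.\<close>
        from Z(2) ev have "eventually (\<lambda>y. y \<in> Z) V"
          by eventually_elim (use G in \<open>auto simp: tower_def\<close>)
        then have "x \<in> Z"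
          using ev_open[of "- Z"] Z(1) V(2) by (auto simp: ultrafilter_eventually_not)
        then show "Z \<in> F i"
          using Z(1) by (simp add: 0 F0)
      qed
    next
      case (Suc j)
      have "eventually (\<lambda>y. G y (Suc j) \<subseteq> G y j) V"
        using ev by eventually_elim (use G i Suc in \<open>auto simp: tower_def\<close>)
      then show ?thesis
        by (auto simp: Suc FS z_limit_def elim: eventually_elim2)
    qed
  next
    fix i m assume i: "i \<le> Suc n"
    show "derived_iter m K \<in> F i \<longleftrightarrow> m + i \<le> Suc n"
    proof (cases i)
      case 0
      then show ?thesis
        using exact_rank_mem_iff[OF Suc.prems] closed_derived_iter[OF K] by (simp add: F0)
    next
      case (Suc j)
      have "eventually (\<lambda>y. derived_iter m K \<in> G y j \<longleftrightarrow> m + j \<le> n) V"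
        using ev by eventually_elim (use G i Suc in \<open>auto simp: tower_def\<close>)
      \<comment> \<open>The inequality does not depend on \<open>y\<close>, so it survives the
        limit; the shifts of \<open>i\<close> and of \<open>n\<close> by one cancel.\<close>
      then have "eventually (\<lambda>y. derived_iter m K \<in> G y j) V \<longleftrightarrow> m + j \<le> n"
        using eventually_subst[of "\<lambda>y. derived_iter m K \<in> G y j" "\<lambda>_. m + j \<le> n" V] ev_const by simp
      then show ?thesis
        using closed_derived_iter[OF K] by (simp add: Suc FS z_limit_def)
    qed
  next
    fix i S assume i: "i \<le> Suc n" and S: "closed S \<and> x \<in> interior S"
    show "S \<in> F i"
    proof (cases i)
      case 0
      then show ?thesis using S interior_subset by (auto simp: F0)
    next
      case (Suc j)
      have "eventually (\<lambda>y. y \<in> interior S) V"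
        using S by (intro ev_open) auto
      with ev have "eventually (\<lambda>y. S \<in> G y j) V"
        by eventually_elim (use G i Suc S in \<open>auto simp: tower_def\<close>)
      then show ?thesis
        using S by (simp add: Suc FS z_limit_def)
    qed
  qed
  then show ?case by (intro exI[of _ F])
qed

lemma tower_antimono:
  assumes "tower K n x F" "i \<le> j" "j \<le> n"
  shows "F j \<subseteq> F i"
proof -
  have "F (i + k) \<subseteq> F i" if "i + k \<le> n" for k
    using that
  proof (induction k)
    case (Suc k)
    then have "F (Suc (i + k)) \<subseteq> F (i + k)"
      using assms(1) by (simp add: tower_def)
    with Suc show ?case by simp
  qed simp
  from this[of "j - i"] show ?thesis
    using assms(2,3) by simp
qed

section \<open>Separated points of unbounded rank\<close>

text \<open>In a monotone sequence the term closest to a given one is adjacent to it, so balls of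
  half that distance are disjoint.\<close>

lemma monoseq_inj_disjoint_nhds:
  fixes x :: "nat \<Rightarrow> real"
  assumes "monoseq x" "inj x"
  obtains W where "\<And>n. open (W n)" "\<And>n. x n \<in> W n" "\<And>m n. m \<noteq> n \<Longrightarrow> W m \<inter> W n = {}"
proof -
  \<comment> \<open>At \<open>n = 0\<close> there is no predecessor, and \<open>n - 1 = 0\<close>
    would give distance 0; the value 1 keeps \<open>d 0\<close> positive.\<close>
  define d where "d n = min \<bar>x (Suc n) - x n\<bar> (if n = 0 then 1 else \<bar>x n - x (n - 1)\<bar>)" for n
  have d_pos: "d n > 0" for n
    using assms(2) by (auto simp: d_def inj_eq)
  have d_le: "d n \<le> dist (x m) (x n)" if "m \<noteq> n" for m n
  proof (cases "n < m")
    case True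
    then have "\<bar>x (Suc n) - x n\<bar> \<le> \<bar>x m - x n\<bar>"
      using assms(1) by (force simp: monoseq_def dest: spec2[of _ n "Suc n"] spec2[of _ "Suc n" m])
    then show ?thesis by (simp add: d_def dist_real_def)
  next
    case False
    then have m: "m \<le> n - 1" "n > 0" using that by auto
    then have "\<bar>x n - x (n - 1)\<bar> \<le> \<bar>x m - x n\<bar>"
      using assms(1) by (force simp: monoseq_def dest: spec2[of _ m "n - 1"] spec2[of _ "n - 1" n])
    then show ?thesis using m by (simp add: d_def dist_real_def)
  qed
  have "ball (x m) (d m / 2) \<inter> ball (x n) (d n / 2) = {}" if "m \<noteq> n" for m n
    using d_le[OF that] d_le[OF that[symmetric]]
    by (intro disjoint_ballI) (simp add: dist_commute)
  then show thesis
    by (rule that[of "\<lambda>n. ball (x n) (d n / 2)", rotated 2]) (use d_pos in simp_all)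
qed

text \<open>Points of different rank are distinct. A monotone subsequence has disjoint
  neighbourhoods, and its indices \<open>s n\<close>, which are the ranks, are at least
  \<open>n\<close>.\<close>

lemma separated_points:
  assumes "closed K" "countable K" "derived_infinity K \<noteq> {}"
  obtains x :: "nat \<Rightarrow> real" and r W where "\<And>n. x n \<in> exact_rank K (r n)" "\<And>n. n \<le> r n"
    "\<And>n. open (W n)" "\<And>n. x n \<in> W n" "\<And>m n. m \<noteq> n \<Longrightarrow> W m \<inter> W n = {}"
proof -
  obtain y where y: "\<And>n. y n \<in> exact_rank K n"
  proof -
    have "\<forall>n. \<exists>z. z \<in> exact_rank K n"
      using exact_rank_nonempty[OF assms] by blast
    then show ?thesis using that by metis
  qed
  obtain s :: "nat \<Rightarrow> nat" where s: "strict_mono s" "monoseq (\<lambda>n. y (s n))"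
    using seq_monosub by blast
  have "inj (\<lambda>n. y (s n))"
  proof (rule injI)
    fix m n assume "y (s m) = y (s n)"
    then have "s m = s n"
      using exact_rank_mem_iff[OF y, of "s m" "s n"] exact_rank_mem_iff[OF y, of "s m" "s m"]
        exact_rank_mem_iff[OF y, of "s n" "s m"] exact_rank_mem_iff[OF y, of "s n" "s n"] by simp
    then show "m = n"
      using s(1) by (simp add: strict_mono_eq)
  qed
  from monoseq_inj_disjoint_nhds[OF s(2) this] obtain W
    where W: "\<And>n. open (W n)" "\<And>n. y (s n) \<in> W n" "\<And>m n. m \<noteq> n \<Longrightarrow> W m \<inter> W n = {}"
    by blast
  show thesis
  proof (rule that[of "\<lambda>n. y (s n)" s W])
    show "n \<le> s n" for n
      using s(1) by (rule strict_mono_imp_increasing)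
  qed (fact y W)+
qed

section \<open>Functions increasing modulo an ultrafilter\<close>

text \<open>
  The functions \<open>first_prefix \<alpha>\<close> can be put into any prescribed order on a finite set of \<open>\<alpha>\<close>'s: let
  \<open>L\<close> list separating prefixes of these \<open>\<alpha>\<close>'s in that order.
\<close>

definition first_prefix :: "(nat \<Rightarrow> bool) \<Rightarrow> bool list list \<Rightarrow> nat" where
  "first_prefix \<alpha> L = length (takeWhile (\<lambda>s. s \<noteq> map \<alpha> [0..<length s]) L)"

lemma first_prefix_le_length: "first_prefix \<alpha> L \<le> length L"
  by (simp add: first_prefix_def length_takeWhile_le)

text \<open>Each of the finitely many pairs gets one coordinate of disagreement; \<open>k\<close>
  exceeds them all.\<close>

lemma finite_separating_prefix:
  fixes A :: "(nat \<Rightarrow> bool) set"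
  assumes "finite A"
  obtains k where "inj_on (\<lambda>\<alpha>. map \<alpha> [0..<k]) A"
proof -
  define d where "d \<alpha> \<beta> = (SOME n. \<alpha> n \<noteq> \<beta> n)" for \<alpha> \<beta> :: "nat \<Rightarrow> bool"
  have d: "\<alpha> (d \<alpha> \<beta>) \<noteq> \<beta> (d \<alpha> \<beta>)" if "\<alpha> \<noteq> \<beta>" for \<alpha> \<beta>
    unfolding d_def by (rule someI_ex) (use that in blast)
  have "finite ((\<lambda>(\<alpha>, \<beta>). d \<alpha> \<beta>) ` (A \<times> A))"
    using assms by simp
  then obtain k where k: "\<And>n. n \<in> (\<lambda>(\<alpha>, \<beta>). d \<alpha> \<beta>) ` (A \<times> A) \<Longrightarrow> n < k"
    by (metis finite_nat_set_iff_bounded)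
  have "inj_on (\<lambda>\<alpha>. map \<alpha> [0..<k]) A"
  proof (rule inj_onI, rule ccontr)
    fix \<alpha> \<beta> assume "\<alpha> \<in> A" "\<beta> \<in> A" "map \<alpha> [0..<k] = map \<beta> [0..<k]" "\<alpha> \<noteq> \<beta>"
    moreover from this have "d \<alpha> \<beta> < k" by (intro k) auto
    ultimately show False using d[of \<alpha> \<beta>] by (auto simp: map_eq_conv)
  qed
  then show thesis by (rule that)
qed

lemma first_prefix_increasing_on_finite:
  fixes r :: "(nat \<Rightarrow> bool) rel"
  assumes r: "linear_order_on (Field r) r" and A: "finite A"
  obtains L where "\<And>\<alpha> \<beta>. \<alpha> \<in> A \<Longrightarrow> \<beta> \<in> A \<Longrightarrow> (\<alpha>, \<beta>) \<in> r \<Longrightarrow> \<alpha> \<noteq> \<beta> \<Longrightarrow>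
    first_prefix \<alpha> L < first_prefix \<beta> L"
proof -
  obtain k where k: "inj_on (\<lambda>\<alpha>. map \<alpha> [0..<k]) A"
    using finite_separating_prefix[OF A] .
  obtain l where l: "set l = A" "distinct l"
    using finite_distinct_list[OF A] by blast
  \<comment> \<open>Counting strict predecessors within \<open>A\<close> turns \<open>r\<close> into
    a numerical sorting key.\<close>
  define p where "p \<alpha> = card {\<gamma> \<in> A. (\<gamma>, \<alpha>) \<in> r \<and> \<gamma> \<noteq> \<alpha>}" for \<alpha>
  define as where "as = sort_key p l"
  have as: "set as = A" "distinct as" "sorted (map p as)"
    using l by (simp_all add: as_def)
  define L where "L = map (\<lambda>\<alpha>. map \<alpha> [0..<k]) as"
  \<comment> \<open>The prefixes of length \<open>k\<close> are pairwise different, so the first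
    match for \<open>as ! i\<close> is its own entry.\<close>
  have first: "first_prefix (as ! i) L = i" if i: "i < length as" for i
    unfolding first_prefix_def
  proof (rule takeWhile_eq_take_P_nth[THEN arg_cong[of _ _ length], THEN trans])
    fix j assume "j < i" "j < length L"
    then show "L ! j \<noteq> map (as ! i) [0..<length (L ! j)]"
    proof -
      have "as ! j \<noteq> as ! i"
        using \<open>j < i\<close> i as(2) by (simp add: nth_eq_iff_index_eq)
      then have "map (as ! j) [0..<k] \<noteq> map (as ! i) [0..<k]"
        using inj_onD[OF k] as(1) i \<open>j < i\<close> by (metis nth_mem order.strict_trans)
      then show ?thesis
        using i \<open>j < i\<close> by (simp add: L_def)
    qed
  qed (use i in \<open>auto simp: L_def\<close>)
  have p: "p \<alpha> < p \<beta>" if "\<alpha> \<in> A" "\<beta> \<in> A" "(\<alpha>, \<beta>) \<in> r" "\<alpha> \<noteq> \<beta>" for \<alpha> \<beta>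
    unfolding p_def
  proof (rule psubset_card_mono)
    have "trans r" "antisym r"
      using r by (auto simp: order_on_defs)
    with that show "{\<gamma> \<in> A. (\<gamma>, \<alpha>) \<in> r \<and> \<gamma> \<noteq> \<alpha>} \<subset> {\<gamma> \<in> A. (\<gamma>, \<beta>) \<in> r \<and> \<gamma> \<noteq> \<beta>}"
      by (auto dest: transD antisymD)
  qed (use A in simp)
  show thesis
  proof (rule that)
    fix \<alpha> \<beta> assume ab: "\<alpha> \<in> A" "\<beta> \<in> A" "(\<alpha>, \<beta>) \<in> r" "\<alpha> \<noteq> \<beta>"
    then obtain i j where ij: "i < length as" "\<alpha> = as ! i" "j < length as" "\<beta> = as ! j"
      using as(1) by (metis in_set_conv_nth)
    have "\<not> j \<le> i"
      using sorted_nth_mono[OF as(3), of j i] p[OF ab] ij by auto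
    then show "first_prefix \<alpha> L < first_prefix \<beta> L"
      using ij by (simp add: first)
  qed
qed

text \<open>By the finite case the sets \<open>S p\<close> have the finite intersection property, so
  a single ultrafilter serves all pairs of \<open>r\<close> at once.\<close>

lemma ultrafilter_first_prefix_increasing:
  fixes r :: "(nat \<Rightarrow> bool) rel"
  assumes r: "linear_order_on (Field r) r"
  obtains U where "ultrafilter U" "\<And>\<alpha> \<beta>. (\<alpha>, \<beta>) \<in> r \<Longrightarrow> \<alpha> \<noteq> \<beta> \<Longrightarrow>
    eventually (\<lambda>L. first_prefix \<alpha> L < first_prefix \<beta> L) U"
proof -
  define S where "S = (\<lambda>(\<alpha>, \<beta>). {L. first_prefix \<alpha> L < first_prefix \<beta> L})"
  have "(INF p\<in>r - Id. principal (S p)) \<noteq> bot"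
  proof (rule INF_filter_not_bot)
    fix X assume X: "X \<subseteq> r - Id" "finite X"
    then have "finite (fst ` X \<union> snd ` X)" by simp
    then obtain L where
      L: "\<And>\<alpha> \<beta>. \<alpha> \<in> fst ` X \<union> snd ` X \<Longrightarrow> \<beta> \<in> fst ` X \<union> snd ` X \<Longrightarrow> (\<alpha>, \<beta>) \<in> r \<Longrightarrow> \<alpha> \<noteq> \<beta> \<Longrightarrow>
        first_prefix \<alpha> L < first_prefix \<beta> L"
      using first_prefix_increasing_on_finite[OF r] by metis
    have "L \<in> S p" if "p \<in> X" for p
      using that X(1) L[of "fst p" "snd p"] by (force simp: S_def split: prod.splits)
    then have "L \<in> (\<Inter>p\<in>X. S p)" by blast
    then show "(INF p\<in>X. principal (S p)) \<noteq> bot"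
      using X(2) by (auto simp: INF_principal_finite principal_eq_bot_iff)
  qed
  then obtain U where U: "U \<le> (INF p\<in>r - Id. principal (S p))" "ultrafilter U"
    by (rule ultrafilter_exists)
  have "eventually (\<lambda>L. first_prefix \<alpha> L < first_prefix \<beta> L) U" if "(\<alpha>, \<beta>) \<in> r" "\<alpha> \<noteq> \<beta>" for \<alpha> \<beta>
  proof (rule filter_leD[OF U(1)], rule eventually_INF1)
    show "(\<alpha>, \<beta>) \<in> r - Id" using that by simp
  qed (simp add: S_def eventually_principal)
  with U(2) show thesis by (rule that)
qed

section \<open>The chain\<close>

text \<open>Levels that rise along \<open>r\<close> modulo \<open>U\<close> give shrinking limits.
  Strictness needs one closed set that separates the two levels in \<open>U\<close>-most towers
  simultaneously.\<close>

lemma prime_z_filter_chain: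
  fixes r :: "(nat \<Rightarrow> bool) rel"
  assumes K: "closed K" "countable K" "derived_infinity K \<noteq> {}" and r: "Well_order r"
  shows "\<exists>Q. decreasing_chain r Q \<and> (\<forall>\<alpha>. prime_z_filter (Q \<alpha>) \<and> K \<in> Q \<alpha>)"
proof -
  obtain x0 :: "nat \<Rightarrow> real" and r0 W0 where pts: "\<And>n. x0 n \<in> exact_rank K (r0 n)" "\<And>n. n \<le> r0 n"
    "\<And>n. open (W0 n)" "\<And>n. x0 n \<in> W0 n" "\<And>m n. m \<noteq> n \<Longrightarrow> W0 m \<inter> W0 n = {}"
    using separated_points[OF K] by metis
  \<comment> \<open>\<open>to_nat\<close> makes \<open>e\<close> injective, and pairing with the
    length gives \<open>length L \<le> e L\<close>, so the tower at \<open>L\<close> has enough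
    levels.\<close>
  define e :: "bool list list \<Rightarrow> nat" where "e L = prod_encode (to_nat L, length L)" for L
  define x where "x L = x0 (e L)" for L
  define n where "n L = r0 (e L)" for L
  define W where "W L = W0 (e L)" for L
  have e_eq: "e L = e M \<longleftrightarrow> L = M" for L M
    by (auto simp: e_def)
  have x: "x L \<in> exact_rank K (n L)" for L
    by (simp add: x_def n_def pts)
  have level_le: "first_prefix \<alpha> L \<le> n L" for \<alpha> L
    using first_prefix_le_length[of \<alpha> L] le_prod_encode_2[of "length L" "to_nat L"] pts(2)[of "e L"]
    unfolding n_def e_def by linarith
  have W: "open (W L)" "x L \<in> W L" "L \<noteq> M \<Longrightarrow> W L \<inter> W M = {}" for L M
    using pts(3-5) by (auto simp: W_def x_def e_eq)
  obtain F where F: "\<And>L. tower K (n L) (x L) (F L)"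
    using tower_exists[OF K(1) x] by metis
  obtain U where U: "ultrafilter U" and incr: "\<And>\<alpha> \<beta>. (\<alpha>, \<beta>) \<in> r \<Longrightarrow> \<alpha> \<noteq> \<beta> \<Longrightarrow>
      eventually (\<lambda>L. first_prefix \<alpha> L < first_prefix \<beta> L) U"
    using ultrafilter_first_prefix_increasing r by (metis well_order_on_def)
  have prime: "prime_z_filter (F L (first_prefix \<alpha> L))" for \<alpha> L
    using F level_le by (simp add: tower_def)
  define Q where "Q \<alpha> = z_limit (\<lambda>L. F L (first_prefix \<alpha> L)) U" for \<alpha>
  have "Q \<beta> \<subset> Q \<alpha>" if ab: "(\<alpha>, \<beta>) \<in> r" "\<alpha> \<noteq> \<beta>" for \<alpha> \<beta>
  proof
    have "eventually (\<lambda>L. F L (first_prefix \<beta> L) \<subseteq> F L (first_prefix \<alpha> L)) U"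
      using incr[OF ab] by eventually_elim (use F level_le tower_antimono in \<open>meson less_imp_le\<close>)
    then show "Q \<beta> \<subseteq> Q \<alpha>"
      by (auto simp: Q_def z_limit_def elim: eventually_elim2)
    \<comment> \<open>This order of derivation makes \<open>first_prefix \<alpha> L\<close> the
      highest level that contains \<open>D L\<close>.\<close>
    define D where "D L = derived_iter (n L - first_prefix \<alpha> L) K" for L
    \<comment> \<open>Since the \<open>W L\<close> are open and disjoint, \<open>Z\<close> is closed and agrees with \<open>D L\<close> on \<open>W L\<close>.\<close>
    define Z where "Z = (\<Inter>L. - W L \<union> D L)"
    have cD: "closed (D L)" for L
      by (simp add: D_def closed_derived_iter K(1))
    have cZ: "closed Z"
      using W(1) cD unfolding Z_def by (intro closed_INT ballI closed_Un) auto
    have ZW: "Z \<inter> W L = D L \<inter> W L" for L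
    proof (intro equalityI subsetI)
      fix y assume y: "y \<in> D L \<inter> W L"
      have "y \<in> - W M \<union> D M" for M
        using y W(3)[of L M] by (cases "L = M") auto
      then show "y \<in> Z \<inter> W L"
        using y by (simp add: Z_def)
    qed (auto simp: Z_def)
    have Z_iff: "Z \<in> F L i \<longleftrightarrow> D L \<in> F L i" if i: "i \<le> n L" for L i
    proof -
      \<comment> \<open>A closed ball around \<open>x L\<close> belongs to every level, so
        membership of a closed set in \<open>F L i\<close> depends only on its trace on that
        ball.\<close>
      obtain d where d: "d > 0" "cball (x L) d \<subseteq> W L"
        using W open_contains_cball by meson
      have P: "prime_z_filter (F L i)"
        using F i by (simp add: tower_def)
      have nhd: "cball (x L) d \<in> F L i"
        using F i d(1) by (auto simp: tower_def interior_cball)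
      have "Z \<inter> cball (x L) d = D L \<inter> cball (x L) d"
        using ZW[of L] d(2) by blast
      then show ?thesis
        using prime_z_filter_Int_iff[OF P] nhd cZ cD by (metis closed_cball)
    qed
    have D_iff: "D L \<in> F L i \<longleftrightarrow> i \<le> first_prefix \<alpha> L" if i: "i \<le> n L" for L i
    proof -
      have "D L \<in> F L i \<longleftrightarrow> n L - first_prefix \<alpha> L + i \<le> n L"
        using F i unfolding D_def tower_def by blast
      then show ?thesis
        using level_le[of \<alpha> L] by linarith
    qed
    have "Z \<in> Q \<alpha>"
      by (simp add: Q_def z_limit_def cZ Z_iff D_iff level_le)
    moreover have "eventually (\<lambda>L. Z \<notin> F L (first_prefix \<beta> L)) U"
      using incr[OF ab] by eventually_elim (simp add: Z_iff D_iff level_le)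
    then have "Z \<notin> Q \<beta>"
      using U by (simp add: Q_def z_limit_def ultrafilter_eventually_not)
    ultimately show "Q \<beta> \<noteq> Q \<alpha>" by blast
  qed
  then have "decreasing_chain r Q"
    using r unfolding decreasing_chain_def by blast
  moreover have "prime_z_filter (Q \<alpha>)" for \<alpha>
    unfolding Q_def using U prime by (intro prime_z_filter_limit) auto
  moreover have "K \<in> Q \<alpha>" for \<alpha>
  proof -
    have "derived_iter 0 K \<in> F L (first_prefix \<alpha> L)" for L
      using F[of L] level_le[of \<alpha> L] unfolding tower_def by (metis add_0)
    then show ?thesis
      by (simp add: Q_def z_limit_def K(1))
  qed
  ultimately show ?thesis by (intro exI[of _ Q]) simp
qed

theorem corollary4p3:
  fixes \<Delta> :: "real set"
  assumes "countable \<Delta>" and "compact \<Delta>"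
    and "derived_infinity \<Delta> \<noteq> {}"
  shows "\<exists>Q :: (nat \<Rightarrow> bool) \<Rightarrow> real set set.
           decreasing_chain continuum Q \<and>
           (\<forall>\<alpha>\<in>Field continuum. prime_z_filter (Q \<alpha>) \<and> \<Delta> \<in> Q \<alpha>)"
proof -
  \<comment> \<open>\<open>cexp\<close> unfolds to \<open>card_of\<close> of a set of functions,
    which is a well-order.\<close>
  have "Well_order continuum"
    unfolding continuum_def cexp_def by (rule card_of_Well_order)
  from prime_z_filter_chain[OF compact_imp_closed[OF assms(2)] assms(1,3) this]
  obtain Q where "decreasing_chain continuum Q" "\<And>\<alpha>. prime_z_filter (Q \<alpha>) \<and> \<Delta> \<in> Q \<alpha>"
    by auto
  then show ?thesis
    by (intro exI[of _ Q]) simp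
qed

end
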